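(* Let $0<q<1$ and let $\beta \in \mathbb{C}\setminus\{0\}$ be such that $\beta^2 \neq q^{k}$ for all $k\in\mathbb{Z}$. Define doubly infinite lower triangular matrices $L^{\beta}(x)$ and $M^{\beta}(x)$, with rows and columns indexed by $m,n\in\mathbb{Z}$, by $$L^{\beta}(x)_{m,n} = \frac{1}{(\beta^2 q^{2n};q)_{m-n}}\, C_{m-n}(x;\beta q^n|q), \qquad n\le m,$$ $$M^{\beta}(x)_{m,n} = \frac{\beta^{m-n} q^{(m-1)(m-n)}}{(\beta^2 q^{m+n-1};q)_{m-n}}\, C_{m-n}(x;\beta^{-1}q^{1-m}|q), \qquad n\le m,$$ and $L^{\beta}(x)_{m,n}=M^{\beta}(x)_{m,n}=0$ for $n>m$. Then $M^{\beta}(x)$ and $L^{\beta}(x)$ are each other's inverse, i.e. $L^{\beta}(x)M^{\beta}(x)=I=M^{\beta}(x)L^{\beta}(x)$, where $I_{m,n}=\delta_{m,n}$ for $m,n\in\mathbb{Z}$.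
   Context: For $a\in\mathbb{C}$ and $n\in\{0,1,2,\dots\}$, $(a;q)_n=\prod_{j=0}^{n-1}(1-aq^j)$, with $(a;q)_0=1$. For every $\beta\in\mathbb{C}$ and $n\in\{0,1,2,\dots\}$ the continuous $q$-ultraspherical polynomial $C_n(x;\beta|q)$ is the polynomial in $x$ determined by $$C_n(x;\beta|q)=\sum_{k=0}^{n}\frac{(\beta;q)_k(\beta;q)_{n-k}}{(q;q)_k(q;q)_{n-k}}\,e^{i(n-2k)\theta},\qquad x=\cos\theta.$$ The matrix products are well defined, since for lower triangular matrices indexed by $\mathbb{Z}$ each entry of the product is a finite sum: $(AB)_{m,n}=\sum_{k=n}^{m}A_{m,k}B_{k,n}$ for $n\le m$, and $(AB)_{m,n}=0$ for $n>m$. *)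

theory Defs
  imports "HOL-Analysis.Analysis" "HOL-Computational_Algebra.Polynomial"
begin

definition qpoch :: "complex \<Rightarrow> complex \<Rightarrow> nat \<Rightarrow> complex" where
  "qpoch a q n = (\<Prod>j<n. 1 - a * q ^ j)"

definition q_ultraspherical_sum :: "nat \<Rightarrow> complex \<Rightarrow> complex \<Rightarrow> complex \<Rightarrow> complex" where
  "q_ultraspherical_sum n \<beta> q \<theta> =
     (\<Sum>k\<le>n. qpoch \<beta> q k * qpoch \<beta> q (n - k) / (qpoch q q k * qpoch q q (n - k))
        * exp (\<i> * of_int (int n - 2 * int k) * \<theta>))"

text \<open>The continuous \<open>q\<close>-ultraspherical polynomial \<open>C\<^sub>n(x;\<beta>|q)\<close>. It is an honest polynomial
  in \<open>x\<close>, so it can be evaluated at every complex \<open>x\<close>; existence and uniqueness are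
  established below, which makes the definite description meaningful. The angle \<open>\<theta>\<close>
  ranges over all of the complex plane; real angles already determine the polynomial.\<close>

definition q_ultraspherical :: "nat \<Rightarrow> complex \<Rightarrow> complex \<Rightarrow> complex poly" where
  "q_ultraspherical n \<beta> q =
     (THE p. \<forall>\<theta>. poly p (cos \<theta>) = q_ultraspherical_sum n \<beta> q \<theta>)"

lemma ex_cos_poly_nat: "\<exists>p. \<forall>\<theta>::complex. poly p (cos \<theta>) = cos (of_nat n * \<theta>)"
proof (induction n rule: less_induct)
  case (less n)
  show ?case
  proof (cases "n < 2")
    case True
    then consider "n = 0" | "n = 1" by linarith
    then show ?thesis
    proof cases
      case 1
      then show ?thesis by (intro exI[of _ "[:1:]"]) simp
    next
      case 2
      then show ?thesis by (intro exI[of _ "[:0, 1:]"]) simp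
    qed
  next
    case False
    then obtain m where m: "n = Suc (Suc m)"
      by (metis add_2_eq_Suc le_Suc_ex not_less)
    obtain p0 where p0: "\<And>\<theta>::complex. poly p0 (cos \<theta>) = cos (of_nat m * \<theta>)"
      using less[of m] m by auto
    obtain p1 where p1: "\<And>\<theta>::complex. poly p1 (cos \<theta>) = cos (of_nat (Suc m) * \<theta>)"
      using less[of "Suc m"] m by auto
    have "poly ([:0, 2:] * p1 - p0) (cos \<theta>) = cos (of_nat n * \<theta>)" for \<theta> :: complex
    proof -
      have a: "of_nat n * \<theta> = of_nat (Suc m) * \<theta> + \<theta>" and
           b: "of_nat m * \<theta> = of_nat (Suc m) * \<theta> - \<theta>"
        by (simp_all add: m algebra_simps)
      show ?thesis
        unfolding poly_diff poly_mult p0 p1 a b cos_add cos_diff by simp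
    qed
    then show ?thesis by blast
  qed
qed

lemma ex_cos_poly_int: "\<exists>p. \<forall>\<theta>::complex. poly p (cos \<theta>) = cos (of_int i * \<theta>)"
proof (cases "i \<ge> 0")
  case True
  then show ?thesis using ex_cos_poly_nat[of "nat i"] by simp
next
  case False
  then have "cos (of_nat (nat (- i)) * \<theta>) = cos (of_int i * \<theta>)" for \<theta> :: complex
    by simp
  then show ?thesis using ex_cos_poly_nat[of "nat (- i)"] by metis
qed

lemma q_ultraspherical_sum_cos:
  "q_ultraspherical_sum n \<beta> q \<theta> =
     (\<Sum>k\<le>n. qpoch \<beta> q k * qpoch \<beta> q (n - k) / (qpoch q q k * qpoch q q (n - k))
        * cos (of_int (int n - 2 * int k) * \<theta>))"
proof -
  define c where "c k = qpoch \<beta> q k * qpoch \<beta> q (n - k) / (qpoch q q k * qpoch q q (n - k))" for k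
  define e where "e k = \<i> * of_int (int n - 2 * int k) * \<theta>" for k
  have c: "c (n - k) = c k" and e: "e (n - k) = - e k" if "k \<le> n" for k
    using that by (simp_all add: c_def e_def of_nat_diff algebra_simps)
  have "(\<Sum>k\<le>n. c k * exp (e k)) = (\<Sum>k\<le>n. c (n - k) * exp (e (n - k)))"
    by (rule sum.reindex_bij_witness[of _ "\<lambda>k. n - k" "\<lambda>k. n - k"]) auto
  also have "\<dots> = (\<Sum>k\<le>n. c k * exp (- e k))"
    by (intro sum.cong) (auto simp: c e)
  finally have "2 * (\<Sum>k\<le>n. c k * exp (e k)) = (\<Sum>k\<le>n. c k * (exp (e k) + exp (- e k)))"
    by (simp add: sum.distrib ring_distribs)
  also have "\<dots> = 2 * (\<Sum>k\<le>n. c k * cos (of_int (int n - 2 * int k) * \<theta>))"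
    unfolding sum_distrib_left
    by (intro sum.cong) (auto simp: cos_exp_eq e_def mult.assoc)
  finally show ?thesis
    by (simp add: q_ultraspherical_sum_def c_def e_def)
qed

lemma ex1_q_ultraspherical:
  "\<exists>!p. \<forall>\<theta>. poly p (cos \<theta>) = q_ultraspherical_sum n \<beta> q \<theta>"
proof (rule ex_ex1I)
  obtain T where T: "\<And>i (\<theta>::complex). poly (T i) (cos \<theta>) = cos (of_int i * \<theta>)"
    using ex_cos_poly_int by metis
  show "\<exists>p. \<forall>\<theta>. poly p (cos \<theta>) = q_ultraspherical_sum n \<beta> q \<theta>"
    by (intro exI[of _ "\<Sum>k\<le>n. smult (qpoch \<beta> q k * qpoch \<beta> q (n - k) / (qpoch q q k * qpoch q q (n - k)))
          (T (int n - 2 * int k))"])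
       (simp add: q_ultraspherical_sum_cos poly_sum T)
next
  fix p r :: "complex poly"
  assume "\<forall>\<theta>. poly p (cos \<theta>) = q_ultraspherical_sum n \<beta> q \<theta>"
     and "\<forall>\<theta>. poly r (cos \<theta>) = q_ultraspherical_sum n \<beta> q \<theta>"
  then have "poly p (cos \<theta>) = poly r (cos \<theta>)" for \<theta> by simp
  then have "poly p x = poly r x" for x by (metis cos_Arccos)
  then show "p = r" by (simp add: poly_eq_poly_eq_iff[symmetric] fun_eq_iff)
qed

lemma poly_q_ultraspherical_cos:
  "poly (q_ultraspherical n \<beta> q) (cos \<theta>) = q_ultraspherical_sum n \<beta> q \<theta>"
  using theI'[OF ex1_q_ultraspherical[of n \<beta> q]] unfolding q_ultraspherical_def by blast

definition L_matrix :: "complex \<Rightarrow> complex \<Rightarrow> complex \<Rightarrow> int \<Rightarrow> int \<Rightarrow> complex" where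
  "L_matrix q \<beta> x m n =
     (if n \<le> m
      then 1 / qpoch (\<beta>^2 * q powi (2 * n)) q (nat (m - n))
             * poly (q_ultraspherical (nat (m - n)) (\<beta> * q powi n) q) x
      else 0)"

definition M_matrix :: "complex \<Rightarrow> complex \<Rightarrow> complex \<Rightarrow> int \<Rightarrow> int \<Rightarrow> complex" where
  "M_matrix q \<beta> x m n =
     (if n \<le> m
      then \<beta> powi (m - n) * q powi ((m - 1) * (m - n))
             / qpoch (\<beta>^2 * q powi (m + n - 1)) q (nat (m - n))
             * poly (q_ultraspherical (nat (m - n)) (inverse \<beta> * q powi (1 - m)) q) x
      else 0)"

text \<open>Product of lower triangular matrices indexed by the integers.\<close>

definition tri_mult ::
  "(int \<Rightarrow> int \<Rightarrow> complex) \<Rightarrow> (int \<Rightarrow> int \<Rightarrow> complex) \<Rightarrow> int \<Rightarrow> int \<Rightarrow> complex" where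
  "tri_mult A B m n = (if n \<le> m then \<Sum>k = n..m. A m k * B k n else 0)"

definition id_matrix :: "int \<Rightarrow> int \<Rightarrow> complex" where
  "id_matrix m n = (if m = n then 1 else 0)"

end

theory Submission
  imports Defs
begin

text \<open>
  Both matrices have ones on the diagonal, so a one-sided inverse of a lower triangular matrix is
  two-sided (\<open>tri_mult_left_inverse_imp_right\<close>), and it suffices to show that \<open>M L\<close> has
  vanishing entries strictly below the diagonal. This product is the easier of the two, because
  its denominators combine into a polynomial.

  Fix an entry at distance \<open>N = n + 1\<close> below the diagonal, in the column where the parameter of
  the polynomials in \<open>L\<close> is \<open>b\<close>. Write \<open>x = cos \<theta>\<close> and expand both polynomials in exponentials.
  Reversing the order of the factors of \<open>(b\<^sup>-\<^sup>1q\<^sup>-\<^sup>n;q)\<^sub>j\<close> expresses everything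
  through \<open>(b;q)\<close> and \<open>(b\<^sup>2;q)\<close>, and the coefficient of \<open>exp (\<i>(N - 2s)\<theta>)\<close> becomes, with \<open>t = N - s\<close>
  and up to a constant factor, the value at \<open>F(u, v) = (b\<^sup>2uv;q)\<^sub>n / ((bu;q)\<^sub>t (bv;q)\<^sub>s)\<close> of the
  divided difference of order \<open>s\<close> in \<open>u\<close> at the nodes \<open>1, q, \<dots>, q\<^sup>s\<close>, followed by that of order \<open>t\<close> in
  \<open>v\<close> at \<open>1, q, \<dots>, q\<^sup>t\<close>.

  This vanishes by counting degrees twice (\<open>double_sum_eq_0\<close>). The numerator has degree
  \<open>n = s + t - 1\<close> in \<open>u\<close>, hence its divided difference over the \<open>s + 1\<close> nodes \<open>q\<^sup>i\<close> together with the \<open>t\<close>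
  zeros \<open>q\<^sup>-\<^sup>l/b\<close> of \<open>(bu;q)\<^sub>t\<close> is zero. The part of it that comes from the nodes \<open>q\<^sup>i\<close>
  is the divided difference in \<open>u\<close> of \<open>F\<close>, up to a constant; it is therefore a combination of the
  values of the numerator at \<open>u = q\<^sup>-\<^sup>l/b\<close>. There the numerator is \<open>(bvq\<^sup>-\<^sup>l;q)\<^sub>n\<close>, which is
  divisible by \<open>(bv;q)\<^sub>s\<close> since \<open>l < t\<close>. The quotient is a polynomial in \<open>v\<close> of degree at most
  \<open>n - s = t - 1\<close>, and the divided difference of order \<open>t\<close> annihilates it.
\<close>

section \<open>Divided differences\<close>

text \<open>The sum is the leading coefficient, in degree \<open>card A - 1\<close>, of the Lagrange interpolation
  polynomial of \<open>p\<close> on \<open>A\<close>, which is \<open>p\<close> itself.\<close>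

lemma divided_difference_eq_0:
  fixes p :: "'a::field poly"
  assumes "finite A" and deg: "degree p + 1 < card A"
  shows "(\<Sum>a\<in>A. poly p a / (\<Prod>c\<in>A - {a}. a - c)) = 0"
proof -
  define l :: "'a \<Rightarrow> 'a poly" where "l a = (\<Prod>c\<in>A - {a}. [:- c, 1:])" for a
  define w where "w a = (\<Prod>c\<in>A - {a}. a - c)" for a
  define r where "r = (\<Sum>a\<in>A. smult (poly p a / w a) (l a))"
  have deg_l: "degree (l a) = card A - 1" if "a \<in> A" for a
    unfolding l_def using that \<open>finite A\<close> by (subst degree_prod_eq_sum_degree) auto
  have "lead_coeff (l a) = 1" for a
    unfolding l_def lead_coeff_prod by simp
  then have coeff_l: "coeff (l a) (card A - 1) = 1" if "a \<in> A" for a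
    using deg_l[OF that] by metis
  have poly_l: "poly (l a) b = (if a = b then w a else 0)" if "b \<in> A" for a b
    using that \<open>finite A\<close> by (auto simp: l_def w_def poly_prod intro: prod.cong)
  have w_nz: "w a \<noteq> 0" for a
    using \<open>finite A\<close> by (auto simp: w_def)
  have "poly r b = poly p b" if "b \<in> A" for b
    using that \<open>finite A\<close> w_nz
    by (simp add: r_def poly_sum poly_l if_distrib sum.delta' cong: if_cong)
  moreover have "degree r \<le> card A - 1"
    unfolding r_def using deg_l \<open>finite A\<close>
    by (intro degree_sum_le) (auto intro: order.trans[OF degree_smult_le])
  ultimately have "r = p"
    using deg by (intro poly_eqI_degree[of A]) auto
  moreover have "coeff p (card A - 1) = 0"
    using deg by (intro coeff_eq_0) linarith
  ultimately have "0 = coeff r (card A - 1)"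
    by simp
  also have "\<dots> = (\<Sum>a\<in>A. poly p a / w a)"
    using coeff_l by (simp add: r_def coeff_sum)
  finally show ?thesis
    by (simp add: w_def)
qed

text \<open>Splitting the nodes of a vanishing divided difference into two groups. With \<open>Z\<close> the zeros of a
  denominator, the left-hand side is a divided difference over \<open>X\<close> of a rational function; the
  right-hand side shows that it sees \<open>p\<close> only through the values at the poles.\<close>

lemma partial_fraction_transfer:
  fixes p :: "'a::field poly"
  assumes fin: "finite X" "finite Z" and disj: "X \<inter> Z = {}"
    and deg: "degree p + 1 < card X + card Z"
  shows "(\<Sum>x\<in>X. poly p x / ((\<Prod>c\<in>X - {x}. x - c) * (\<Prod>z\<in>Z. x - z)))
       = - (\<Sum>z\<in>Z. poly p z / ((\<Prod>c\<in>Z - {z}. z - c) * (\<Prod>x\<in>X. z - x)))"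
proof -
  have "0 = (\<Sum>a\<in>X \<union> Z. poly p a / (\<Prod>c\<in>X \<union> Z - {a}. a - c))"
    using fin deg disj by (intro divided_difference_eq_0[symmetric]) (auto simp: card_Un_disjoint)
  also have "\<dots> = (\<Sum>a\<in>X. poly p a / (\<Prod>c\<in>X \<union> Z - {a}. a - c))
                + (\<Sum>a\<in>Z. poly p a / (\<Prod>c\<in>X \<union> Z - {a}. a - c))"
    using fin disj by (rule sum.union_disjoint)
  also have "(\<Sum>a\<in>X. poly p a / (\<Prod>c\<in>X \<union> Z - {a}. a - c))
      = (\<Sum>x\<in>X. poly p x / ((\<Prod>c\<in>X - {x}. x - c) * (\<Prod>z\<in>Z. x - z)))"
  proof (intro sum.cong refl)
    fix x assume "x \<in> X"
    then have "X \<union> Z - {x} = (X - {x}) \<union> Z" using disj by auto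
    then show "poly p x / (\<Prod>c\<in>X \<union> Z - {x}. x - c)
             = poly p x / ((\<Prod>c\<in>X - {x}. x - c) * (\<Prod>z\<in>Z. x - z))"
      using fin disj by (subst prod.union_disjoint[symmetric]) auto
  qed
  also have "(\<Sum>a\<in>Z. poly p a / (\<Prod>c\<in>X \<union> Z - {a}. a - c))
      = (\<Sum>z\<in>Z. poly p z / ((\<Prod>c\<in>Z - {z}. z - c) * (\<Prod>x\<in>X. z - x)))"
  proof (intro sum.cong refl)
    fix z assume "z \<in> Z"
    then have "X \<union> Z - {z} = (Z - {z}) \<union> X" using disj by auto
    then show "poly p z / (\<Prod>c\<in>X \<union> Z - {z}. z - c)
             = poly p z / ((\<Prod>c\<in>Z - {z}. z - c) * (\<Prod>x\<in>X. z - x))"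
      using fin disj by (subst prod.union_disjoint[symmetric]) auto
  qed
  finally show ?thesis
    by (simp add: eq_neg_iff_add_eq_0)
qed

section \<open>Shifted factorials and powers of \<open>q\<close>\<close>

lemma qpoch_add: "qpoch a q (m + n) = qpoch a q m * qpoch (a * q ^ m) q n"
  by (induction n) (simp_all add: qpoch_def power_add algebra_simps)

lemma qpoch_Suc: "qpoch a q (Suc n) = qpoch a q n * (1 - a * q ^ n)"
  by (simp add: qpoch_def)

definition qpoch_poly :: "complex \<Rightarrow> complex \<Rightarrow> nat \<Rightarrow> complex poly" where
  "qpoch_poly c q n = (\<Prod>j<n. [:1, - (c * q ^ j):])"

lemma poly_qpoch_poly: "poly (qpoch_poly c q n) x = qpoch (c * x) q n"
  by (simp add: qpoch_poly_def qpoch_def poly_prod algebra_simps)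

lemma degree_qpoch_poly_le: "degree (qpoch_poly c q n) \<le> n"
proof -
  have "degree (qpoch_poly c q n) \<le> (\<Sum>j<n. degree [:1, - (c * q ^ j):])"
    unfolding qpoch_poly_def by (rule order.trans[OF degree_prod_sum_le]) auto
  also have "\<dots> \<le> (\<Sum>j<n. 1)"
    by (intro sum_mono) (simp add: degree_pCons_eq_if)
  finally show ?thesis by simp
qed

text \<open>This is \<open>(-1)\<^sup>n q\<^bsup>n(n-1)/2\<^esup>\<close>, the factor that appears when the order of a
  shifted factorial is reversed.\<close>

definition signed_qpow :: "complex \<Rightarrow> nat \<Rightarrow> complex" where
  "signed_qpow q n = (\<Prod>j<n. - (q ^ j))"

lemma signed_qpow_nonzero: "q \<noteq> 0 \<Longrightarrow> signed_qpow q n \<noteq> 0"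
  by (simp add: signed_qpow_def)

lemma signed_qpow_add: "signed_qpow q (m + n) = signed_qpow q m * (q ^ m) ^ n * signed_qpow q n"
  by (induction n) (simp_all add: signed_qpow_def power_add)

text \<open>The factors with \<open>j < i\<close> give \<open>(q;q)\<^sub>i\<close> and those with \<open>j > i\<close> give \<open>(q;q)\<^bsub>s-i\<^esub>\<close>, once the smaller power
  of \<open>q\<close> is extracted from each.\<close>

lemma prod_diff_q_powers:
  assumes "i \<le> s"
  shows "(\<Prod>j\<in>{..s} - {i}. q ^ i - q ^ j) * signed_qpow q (s - i)
       = signed_qpow q s * qpoch q q i * qpoch q q (s - i)"
proof -
  have low: "(\<Prod>j<i. q ^ i - q ^ j) = signed_qpow q i * qpoch q q i"
  proof -
    have "(\<Prod>j<i. q ^ i - q ^ j) = (\<Prod>j<i. - (q ^ j) * (1 - q ^ (i - j)))"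
      by (intro prod.cong) (auto simp: algebra_simps simp flip: power_add)
    also have "\<dots> = signed_qpow q i * (\<Prod>j<i. 1 - q ^ (i - j))"
      by (simp only: prod.distrib signed_qpow_def)
    also have "(\<Prod>j<i. 1 - q ^ (i - j)) = (\<Prod>j<i. 1 - q ^ Suc j)"
      by (rule prod.reindex_bij_witness[of _ "\<lambda>j. i - Suc j" "\<lambda>j. i - Suc j"]) (auto simp: Suc_diff_Suc)
    finally show ?thesis by (simp add: qpoch_def)
  qed
  have high: "(\<Prod>j\<in>{i<..s}. q ^ i - q ^ j) = (q ^ i) ^ (s - i) * qpoch q q (s - i)"
  proof -
    have "(\<Prod>j\<in>{i<..s}. q ^ i - q ^ j) = (\<Prod>j<s - i. q ^ i * (1 - q * q ^ j))"
      by (rule prod.reindex_bij_witness[of _ "\<lambda>j. i + Suc j" "\<lambda>j. j - Suc i"])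
         (auto simp: algebra_simps simp flip: power_add power_Suc)
    also have "\<dots> = (q ^ i) ^ (s - i) * qpoch q q (s - i)"
      by (simp add: prod.distrib qpoch_def)
    finally show ?thesis .
  qed
  have "{..s} - {i} = {..<i} \<union> {i<..s}" using assms by auto
  then have "(\<Prod>j\<in>{..s} - {i}. q ^ i - q ^ j)
      = (\<Prod>j<i. q ^ i - q ^ j) * (\<Prod>j\<in>{i<..s}. q ^ i - q ^ j)"
    by (simp add: prod.union_disjoint Int_def)
  moreover have "signed_qpow q s = signed_qpow q i * (q ^ i) ^ (s - i) * signed_qpow q (s - i)"
    using signed_qpow_add[of q i "s - i"] assms by simp
  ultimately show ?thesis
    by (simp add: low high)
qed

lemma inj_power_not_root_of_unity:
  fixes q :: "'a::field"
  assumes "q \<noteq> 0" and nroot: "\<And>k. k > 0 \<Longrightarrow> q ^ k \<noteq> 1"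
  shows "inj (\<lambda>i::nat. q ^ i)"
proof (rule linorder_injI)
  fix i j :: nat assume "i < j"
  then have "q ^ j = q ^ i * q ^ (j - i)" by (simp flip: power_add)
  then show "q ^ i \<noteq> q ^ j" using assms \<open>i < j\<close> by simp
qed

lemma qpoch_nonzero: "(\<And>k. k < n \<Longrightarrow> a * q ^ k \<noteq> 1) \<Longrightarrow> qpoch a q n \<noteq> 0"
  by (auto simp: qpoch_def)

section \<open>Vanishing of the double \<open>q\<close>-difference\<close>

definition node_weight :: "complex \<Rightarrow> nat \<Rightarrow> nat \<Rightarrow> complex" where
  "node_weight q s i = signed_qpow q (s - i) / (qpoch q q i * qpoch q q (s - i))"

text \<open>The coefficients produced by the two polynomial expansions are those of the divided difference
  at \<open>1, q, \<dots>, q\<^sup>s\<close>, up to a factor independent of the node.\<close>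

lemma node_weight_eq:
  assumes "q \<noteq> 0" and nroot: "\<And>k. k > 0 \<Longrightarrow> q ^ k \<noteq> 1" and "i \<le> s"
  shows "node_weight q s i = signed_qpow q s / (\<Prod>c\<in>(\<lambda>j. q ^ j) ` {..s} - {q ^ i}. q ^ i - c)"
proof -
  have inj: "inj (\<lambda>i::nat. q ^ i)"
    using assms by (intro inj_power_not_root_of_unity)
  have "(\<Prod>c\<in>(\<lambda>j. q ^ j) ` {..s} - {q ^ i}. q ^ i - c)
      = (\<Prod>c\<in>(\<lambda>j. q ^ j) ` ({..s} - {i}). q ^ i - c)"
    using inj by (intro prod.cong) (auto simp: inj_def)
  also have "\<dots> = (\<Prod>j\<in>{..s} - {i}. q ^ i - q ^ j)"
    using inj by (subst prod.reindex) (auto simp: inj_def inj_on_def)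
  finally have eq: "(\<Prod>c\<in>(\<lambda>j. q ^ j) ` {..s} - {q ^ i}. q ^ i - c) = (\<Prod>j\<in>{..s} - {i}. q ^ i - q ^ j)" .
  have nz: "qpoch q q j \<noteq> 0" for j
    using nroot[of "Suc _"] by (intro qpoch_nonzero) simp
  have nz': "(\<Prod>j\<in>{..s} - {i}. q ^ i - q ^ j) \<noteq> 0"
    using inj by (auto simp: inj_def)
  show ?thesis
    unfolding eq node_weight_def
    using prod_diff_q_powers[OF \<open>i \<le> s\<close>, of q] nz nz' signed_qpow_nonzero[OF \<open>q \<noteq> 0\<close>]
    by (simp add: field_simps)
qed

lemma sum_node_weight_poly_eq_0:
  assumes "q \<noteq> 0" and nroot: "\<And>k. k > 0 \<Longrightarrow> q ^ k \<noteq> 1" and "degree p < s"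
  shows "(\<Sum>i\<le>s. node_weight q s i * poly p (q ^ i)) = 0"
proof -
  have inj: "inj (\<lambda>i::nat. q ^ i)"
    using assms by (intro inj_power_not_root_of_unity)
  let ?X = "(\<lambda>j. q ^ j) ` {..s}"
  have "card ?X = Suc s"
    using inj by (subst card_image) (auto simp: inj_on_def inj_def)
  then have "(\<Sum>x\<in>?X. poly p x / (\<Prod>c\<in>?X - {x}. x - c)) = 0"
    using \<open>degree p < s\<close> by (intro divided_difference_eq_0) auto
  moreover have "(\<Sum>i\<le>s. node_weight q s i * poly p (q ^ i))
      = (\<Sum>i\<le>s. signed_qpow q s * (poly p (q ^ i) / (\<Prod>c\<in>?X - {q ^ i}. q ^ i - c)))"
    using assms by (intro sum.cong) (simp_all add: node_weight_eq)
  moreover have "\<dots> = signed_qpow q s * (\<Sum>x\<in>?X. poly p x / (\<Prod>c\<in>?X - {x}. x - c))"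
    using inj by (subst sum.reindex) (auto simp: inj_on_def inj_def sum_distrib_left)
  ultimately show ?thesis by simp
qed

text \<open>The function to which the divided difference is applied has at most simple poles at the points
  \<open>1/(b q\<^sup>l)\<close>, and its polynomial part has degree below \<open>s\<close> and is annihilated. What matters
  is that the coefficients \<open>c\<close> do not depend on \<open>p\<close>: below, \<open>p\<close> varies with a second variable.\<close>

lemma sum_node_weight_over_qpoch:
  assumes "q \<noteq> 0" and nroot: "\<And>k. k > 0 \<Longrightarrow> q ^ k \<noteq> 1"
    and "b \<noteq> 0" and b: "\<And>k. b * q ^ k \<noteq> 1"
  obtains c where
    "\<And>p. degree p < s + t \<Longrightarrow>
       (\<Sum>i\<le>s. node_weight q s i * (poly p (q ^ i) / qpoch (b * q ^ i) q t))
         = (\<Sum>l<t. c l * poly p (inverse (b * q ^ l)))"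
proof -
  have inj: "inj (\<lambda>i::nat. q ^ i)"
    using assms by (intro inj_power_not_root_of_unity)
  define X where "X = (\<lambda>j. q ^ j) ` {..s}"
  define z where "z l = inverse (b * q ^ l)" for l
  define Z where "Z = z ` {..<t}"
  define h where "h u = - inverse ((\<Prod>c\<in>Z - {u}. u - c) * (\<Prod>x\<in>X. u - x))" for u
  define K where "K = (\<Prod>l<t. - z l)"
  have injz: "inj z"
    using inj \<open>b \<noteq> 0\<close> by (auto simp: inj_def z_def)
  have cX: "card X = Suc s"
    using inj unfolding X_def by (subst card_image) (auto simp: inj_on_def inj_def)
  have cZ: "card Z = t"
    using injz unfolding Z_def by (subst card_image) (auto simp: inj_on_def inj_def)
  have disj: "X \<inter> Z = {}"
  proof -
    have "q ^ i \<noteq> z l" for i l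
    proof
      assume "q ^ i = z l"
      then have "b * q ^ (i + l) = 1"
        using \<open>b \<noteq> 0\<close> \<open>q \<noteq> 0\<close> by (simp add: z_def power_add field_simps)
      then show False using b by blast
    qed
    then show ?thesis by (auto simp: X_def Z_def)
  qed
  have K_nz: "K \<noteq> 0"
    using assms by (simp add: K_def z_def)
  have factor: "(\<Prod>u\<in>Z. x - u) = K * qpoch (b * x) q t" for x
  proof -
    have "(\<Prod>u\<in>Z. x - u) = (\<Prod>l<t. x - z l)"
      unfolding Z_def using injz by (subst prod.reindex) (auto simp: inj_on_def inj_def)
    also have "\<dots> = (\<Prod>l<t. - z l * (1 - b * x * q ^ l))"
      using \<open>b \<noteq> 0\<close> \<open>q \<noteq> 0\<close> by (intro prod.cong) (auto simp: z_def field_simps)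
    finally show ?thesis by (simp only: prod.distrib K_def qpoch_def)
  qed
  show thesis
  proof (rule that)
    fix p :: "complex poly"
    assume deg: "degree p < s + t"
    have "(\<Sum>i\<le>s. node_weight q s i * (poly p (q ^ i) / qpoch (b * q ^ i) q t))
        = (\<Sum>i\<le>s. signed_qpow q s * K * (poly p (q ^ i) /
              ((\<Prod>c\<in>X - {q ^ i}. q ^ i - c) * (\<Prod>u\<in>Z. q ^ i - u))))"
      using assms K_nz by (intro sum.cong) (simp_all add: node_weight_eq factor X_def)
    also have "\<dots> = signed_qpow q s * K *
        (\<Sum>x\<in>X. poly p x / ((\<Prod>c\<in>X - {x}. x - c) * (\<Prod>u\<in>Z. x - u)))"
      unfolding X_def using inj
      by (subst sum.reindex) (auto simp: inj_on_def inj_def sum_distrib_left)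
    also have "(\<Sum>x\<in>X. poly p x / ((\<Prod>c\<in>X - {x}. x - c) * (\<Prod>u\<in>Z. x - u)))
        = (\<Sum>u\<in>Z. h u * poly p u)"
      using deg disj cX cZ
      by (subst partial_fraction_transfer)
         (auto simp: X_def Z_def h_def sum_negf[symmetric] divide_inverse mult.commute intro!: sum.cong)
    also have "\<dots> = (\<Sum>l<t. h (z l) * poly p (z l))"
      unfolding Z_def using injz by (subst sum.reindex) (auto simp: inj_on_def inj_def)
    finally show "(\<Sum>i\<le>s. node_weight q s i * (poly p (q ^ i) / qpoch (b * q ^ i) q t))
        = (\<Sum>l<t. (signed_qpow q s * K * h (z l)) * poly p (inverse (b * q ^ l)))"
      by (simp add: z_def sum_distrib_left mult.assoc)
  qed
qed

text \<open>The sum over \<open>i\<close> replaces \<open>q\<^sup>i\<close> by the poles \<open>1/(b q\<^sup>l)\<close> with \<open>l < t\<close>. At each of them the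
  numerator cancels the remaining denominator and leaves a polynomial in \<open>q\<^sup>r\<close> of degree
  below \<open>t\<close>, which the sum over \<open>r\<close> kills.\<close>

lemma double_sum_eq_0:
  assumes "q \<noteq> 0" and nroot: "\<And>k. k > 0 \<Longrightarrow> q ^ k \<noteq> 1"
    and "b \<noteq> 0" and b: "\<And>k. b * q ^ k \<noteq> 1" and st: "s + t = Suc n"
  shows "(\<Sum>i\<le>s. \<Sum>r\<le>t. node_weight q s i * node_weight q t r *
           (qpoch (b\<^sup>2 * q ^ (i + r)) q n / (qpoch (b * q ^ i) q t * qpoch (b * q ^ r) q s))) = 0"
proof -
  obtain c where c: "\<And>p. degree p < s + t \<Longrightarrow>
       (\<Sum>i\<le>s. node_weight q s i * (poly p (q ^ i) / qpoch (b * q ^ i) q t))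
         = (\<Sum>l<t. c l * poly p (inverse (b * q ^ l)))"
    using sum_node_weight_over_qpoch[of q b s t] assms(1-4) by blast
  have nz: "qpoch (b * q ^ r) q s \<noteq> 0" for r
    using b by (intro qpoch_nonzero) (simp add: mult.assoc flip: power_add)
  have inner: "(\<Sum>r\<le>t. node_weight q t r *
      (qpoch (b\<^sup>2 * q ^ r * inverse (b * q ^ l)) q n / qpoch (b * q ^ r) q s)) = 0" if "l < t" for l
  proof -
    \<comment> \<open>The \<open>n\<close> factors of the numerator have exponents \<open>-l, \<dots>, n-1-l\<close>. The denominator takes
      those from \<open>0\<close> to \<open>s-1\<close>; the negative ones and those from \<open>s\<close> on make up \<open>R\<close>.\<close>
    define R where "R = qpoch_poly (b * inverse (q ^ l)) q l * qpoch_poly (b * q ^ s) q (t - 1 - l)"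
    have "degree R \<le> l + (t - 1 - l)"
      unfolding R_def
      by (rule order.trans[OF degree_mult_le]) (intro add_mono degree_qpoch_poly_le)
    then have deg: "degree R < t" using that by linarith
    have n: "n = l + (s + (t - 1 - l))" using st that by linarith
    have "qpoch (b\<^sup>2 * q ^ r * inverse (b * q ^ l)) q n / qpoch (b * q ^ r) q s = poly R (q ^ r)" for r
    proof -
      have a: "b\<^sup>2 * q ^ r * inverse (b * q ^ l) = b * inverse (q ^ l) * q ^ r"
        using \<open>b \<noteq> 0\<close> by (simp add: power2_eq_square field_simps)
      have a': "b * inverse (q ^ l) * q ^ r * q ^ l = b * q ^ r"
        using \<open>q \<noteq> 0\<close> by simp
      show ?thesis
        unfolding a n qpoch_add a' R_def poly_mult poly_qpoch_poly
        using nz[of r] by (simp add: mult_ac)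
    qed
    then show ?thesis
      using sum_node_weight_poly_eq_0[OF assms(1,2) deg] by simp
  qed
  have "(\<Sum>i\<le>s. \<Sum>r\<le>t. node_weight q s i * node_weight q t r *
           (qpoch (b\<^sup>2 * q ^ (i + r)) q n / (qpoch (b * q ^ i) q t * qpoch (b * q ^ r) q s)))
      = (\<Sum>r\<le>t. \<Sum>i\<le>s. node_weight q s i * node_weight q t r *
           (qpoch (b\<^sup>2 * q ^ (i + r)) q n / (qpoch (b * q ^ i) q t * qpoch (b * q ^ r) q s)))"
    by (rule sum.swap)
  also have "\<dots> = (\<Sum>r\<le>t. node_weight q t r / qpoch (b * q ^ r) q s *
      (\<Sum>i\<le>s. node_weight q s i * (poly (qpoch_poly (b\<^sup>2 * q ^ r) q n) (q ^ i) / qpoch (b * q ^ i) q t)))"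
    unfolding sum_distrib_left
    by (intro sum.cong) (simp_all add: poly_qpoch_poly power_add mult_ac)
  also have "\<dots> = (\<Sum>r\<le>t. node_weight q t r / qpoch (b * q ^ r) q s *
      (\<Sum>l<t. c l * qpoch (b\<^sup>2 * q ^ r * inverse (b * q ^ l)) q n))"
    using st by (subst c) (auto intro: le_less_trans[OF degree_qpoch_poly_le] simp: poly_qpoch_poly)
  also have "\<dots> = (\<Sum>l<t. c l * (\<Sum>r\<le>t. node_weight q t r *
      (qpoch (b\<^sup>2 * q ^ r * inverse (b * q ^ l)) q n / qpoch (b * q ^ r) q s)))"
    unfolding sum_distrib_left by (subst sum.swap) (simp add: mult_ac)
  also have "\<dots> = 0"
    by (rule sum.neutral) (use inner in \<open>auto simp del: inverse_mult_distrib\<close>)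
  finally show ?thesis .
qed

section \<open>Inverses of lower triangular matrices\<close>

lemma tri_mult_assoc: "tri_mult (tri_mult A B) C = tri_mult A (tri_mult B C)"
proof (intro ext)
  fix m n :: int
  show "tri_mult (tri_mult A B) C m n = tri_mult A (tri_mult B C) m n"
  proof (cases "n \<le> m")
    case True
    have "tri_mult (tri_mult A B) C m n = (\<Sum>k=n..m. \<Sum>l=k..m. A m l * B l k * C k n)"
      using True by (simp add: tri_mult_def sum_distrib_right)
    also have "\<dots> = (\<Sum>(k, l)\<in>(SIGMA k:{n..m}. {k..m}). A m l * B l k * C k n)"
      by (simp add: sum.Sigma)
    also have "\<dots> = (\<Sum>(l, k)\<in>(SIGMA l:{n..m}. {n..l}). A m l * B l k * C k n)"
      by (rule sum.reindex_bij_witness[of _ prod.swap prod.swap]) auto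
    also have "\<dots> = (\<Sum>l=n..m. \<Sum>k=n..l. A m l * B l k * C k n)"
      by (simp add: sum.Sigma)
    also have "\<dots> = tri_mult A (tri_mult B C) m n"
      using True by (simp add: tri_mult_def sum_distrib_left mult.assoc)
    finally show ?thesis .
  qed (simp add: tri_mult_def)
qed

text \<open>The matrices \<open>B A\<close> and \<open>I\<close> agree after multiplication by \<open>A\<close> from the left, as
  \<open>A (B A) = (A B) A = A\<close>. The diagonal of \<open>A\<close> has no zeros, so forward substitution along
  each column gives \<open>B A = I\<close>.\<close>

lemma tri_mult_left_inverse_imp_right:
  assumes "tri_mult A B = id_matrix"
  shows "tri_mult B A = id_matrix"
proof -
  have diag: "A m m \<noteq> 0" for m
  proof -
    have "tri_mult A B m m = 1" by (simp add: assms id_matrix_def)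
    then show ?thesis by (auto simp: tri_mult_def)
  qed
  have id: "tri_mult A (tri_mult B A) m n = A m n" if "n \<le> m" for m n
  proof -
    have "id_matrix m k * A k n = (if k = m then A k n else 0)" for k
      by (simp add: id_matrix_def)
    then show ?thesis
      using that unfolding tri_mult_assoc[symmetric] assms by (simp add: tri_mult_def)
  qed
  have "tri_mult B A (n + int d) n = id_matrix (n + int d) n" for n d
  proof (induction d rule: less_induct)
    case (less d)
    let ?m = "n + int d"
    have eq: "{n..?m} = insert ?m {n..<?m}" by auto
    have IH: "tri_mult B A k n = id_matrix k n" if "k \<in> {n..<?m}" for k
      using less[of "nat (k - n)"] that by (simp add: nat_less_iff)
    have "A ?m n = (\<Sum>k=n..?m. A ?m k * tri_mult B A k n)"
      using id[of n ?m] by (simp add: tri_mult_def[of A])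
    also have "\<dots> = A ?m ?m * tri_mult B A ?m n + (\<Sum>k\<in>{n..<?m}. A ?m k * id_matrix k n)"
      unfolding eq using IH by simp
    finally have *: "A ?m n = A ?m ?m * tri_mult B A ?m n + (\<Sum>k\<in>{n..<?m}. A ?m k * id_matrix k n)" .
    have "(\<Sum>k\<in>{n..<?m}. A ?m k * id_matrix k n) = (if d = 0 then 0 else A ?m n)"
      by (simp add: id_matrix_def if_distrib sum.delta cong: if_cong)
    then show ?case
      using * diag[of ?m] by (cases "d = 0") (auto simp: id_matrix_def)
  qed
  then have "tri_mult B A m n = id_matrix m n" if "n \<le> m" for m n
    using that by (metis zle_iff_zadd)
  moreover have "tri_mult B A m n = id_matrix m n" if "\<not> n \<le> m" for m n
    using that by (auto simp: tri_mult_def id_matrix_def)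
  ultimately show ?thesis by (intro ext) blast
qed

section \<open>The entries of the product \<open>M L\<close>\<close>

text \<open>With \<open>d = b q\<^sup>n\<close>, each factor satisfies \<open>d (1 - q\<^sup>j/d) = -q\<^sup>j (1 - b q\<^bsup>n-j\<^esup>)\<close>, so the
  left-hand side reassembles \<open>(b;q)\<^bsub>n+1\<^esub>\<close> starting from its last factors.\<close>

lemma qpoch_inverse_reversal:
  assumes "b \<noteq> 0" "q \<noteq> 0" "j \<le> Suc n"
  shows "(b * q ^ n) ^ j * qpoch (inverse (b * q ^ n)) q j * qpoch b q (Suc n - j)
       = signed_qpow q j * qpoch b q (Suc n)"
  using \<open>j \<le> Suc n\<close>
proof (induction j)
  case 0
  then show ?case by (simp add: qpoch_def signed_qpow_def)
next
  case (Suc j)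
  define d where "d = b * q ^ n"
  have d: "d \<noteq> 0" using assms by (simp add: d_def)
  have "q ^ n = q ^ j * q ^ (n - j)" using Suc.prems by (simp flip: power_add)
  then have "d = b * q ^ (n - j) * q ^ j"
    by (simp add: d_def mult_ac)
  moreover have "d * (inverse d * q ^ j) = q ^ j"
    using d by (simp flip: mult.assoc)
  ultimately have step: "d * (1 - inverse d * q ^ j) = - (q ^ j) * (1 - b * q ^ (n - j))"
    by (simp only: right_diff_distrib) (simp add: algebra_simps)
  have "d ^ Suc j * qpoch (inverse d) q (Suc j) * qpoch b q (Suc n - Suc j)
      = d ^ j * qpoch (inverse d) q j * (d * (1 - inverse d * q ^ j)) * qpoch b q (n - j)"
    by (simp add: qpoch_Suc mult_ac)
  also have "\<dots> = - (q ^ j) * (d ^ j * qpoch (inverse d) q j * qpoch b q (Suc n - j))"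
    unfolding step using Suc.prems by (simp add: Suc_diff_le qpoch_Suc mult_ac)
  also have "\<dots> = - (q ^ j) * (signed_qpow q j * qpoch b q (Suc n))"
    using Suc by (simp add: d_def)
  finally show ?case by (simp add: d_def signed_qpow_def)
qed


text \<open>One term of the product of the two expansions, with \<open>i + r\<close> as the index of summation of the
  matrix product. Reversal of the factorials in \<open>1/d\<close> leaves \<open>(b;q)\<^sub>i/(b;q)\<^bsub>t+i\<^esub>\<close> and
  \<open>(b;q)\<^sub>r/(b;q)\<^bsub>s+r\<^esub>\<close>, which are the reciprocals of the denominators on the right. The factorials
  in \<open>b\<^sup>2\<close> are the two outer blocks of \<open>(b\<^sup>2;q)\<^bsub>n+N\<^esub>\<close>; its middle block of length \<open>n\<close> is the
  numerator.\<close>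

lemma node_weight_term:
  assumes q: "q \<noteq> 0" and nroot: "\<And>k. k > 0 \<Longrightarrow> q ^ k \<noteq> 1"
    and "b \<noteq> 0" and b: "\<And>k. b * q ^ k \<noteq> 1" and b2: "\<And>k. b\<^sup>2 * q ^ k \<noteq> 1"
    and N: "N = Suc n" "s + t = N" "i \<le> s" "r \<le> t" and d: "d = b * q ^ n"
  shows "d ^ (N - (i + r)) / qpoch (b\<^sup>2 * q ^ (n + (i + r))) q (N - (i + r)) *
           (qpoch (inverse d) q (s - i) * qpoch (inverse d) q (t - r) /
             (qpoch q q (s - i) * qpoch q q (t - r))) *
         (1 / qpoch (b\<^sup>2) q (i + r) * (qpoch b q i * qpoch b q r / (qpoch q q i * qpoch q q r)))
       = (qpoch b q N)\<^sup>2 / qpoch (b\<^sup>2) q (n + N) * (node_weight q s i * node_weight q t r *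
           (qpoch (b\<^sup>2 * q ^ (i + r)) q n / (qpoch (b * q ^ i) q t * qpoch (b * q ^ r) q s)))"
proof -
  have b_nz: "qpoch (b * q ^ k) q j \<noteq> 0" for k j
    using b by (intro qpoch_nonzero) (simp add: mult.assoc flip: power_add)
  have b0_nz: "qpoch b q j \<noteq> 0" for j using b_nz[of 0] by simp
  have b2_nz: "qpoch (b\<^sup>2 * q ^ k) q j \<noteq> 0" for k j
    using b2 by (intro qpoch_nonzero) (simp add: mult.assoc flip: power_add)
  have b20_nz: "qpoch (b\<^sup>2) q j \<noteq> 0" for j using b2_nz[of 0] by simp
  have q_nz: "qpoch q q j \<noteq> 0" for j
    using nroot[of "Suc _"] by (intro qpoch_nonzero) simp
  have dpow: "d ^ (N - (i + r)) = d ^ (s - i) * d ^ (t - r)"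
    using N by (simp flip: power_add)
  have rev1: "d ^ (s - i) * qpoch (inverse d) q (s - i)
      = signed_qpow q (s - i) * qpoch b q N / (qpoch b q i * qpoch (b * q ^ i) q t)"
  proof -
    have "Suc n - (s - i) = i + t" using N by simp
    with qpoch_inverse_reversal[of b q "s - i" n] N d \<open>b \<noteq> 0\<close> q b_nz b0_nz
    show ?thesis by (simp add: qpoch_add field_simps)
  qed
  have rev2: "d ^ (t - r) * qpoch (inverse d) q (t - r)
      = signed_qpow q (t - r) * qpoch b q N / (qpoch b q r * qpoch (b * q ^ r) q s)"
  proof -
    have "Suc n - (t - r) = r + s" using N by simp
    with qpoch_inverse_reversal[of b q "t - r" n] N d \<open>b \<noteq> 0\<close> q b_nz b0_nz
    show ?thesis by (simp add: qpoch_add field_simps)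
  qed
  have "qpoch (b\<^sup>2) q (n + N) = qpoch (b\<^sup>2) q ((i + r) + (n + (N - (i + r))))"
    using N by simp
  also have "\<dots> = qpoch (b\<^sup>2) q (i + r) * qpoch (b\<^sup>2 * q ^ (i + r)) q n *
       qpoch (b\<^sup>2 * q ^ (n + (i + r))) q (N - (i + r))"
    by (simp only: qpoch_add) (simp add: power_add mult_ac)
  finally have denom: "qpoch (b\<^sup>2) q (n + N) = qpoch (b\<^sup>2) q (i + r) * qpoch (b\<^sup>2 * q ^ (i + r)) q n *
       qpoch (b\<^sup>2 * q ^ (n + (i + r))) q (N - (i + r))" .
  have "d ^ (N - (i + r)) / qpoch (b\<^sup>2 * q ^ (n + (i + r))) q (N - (i + r)) *
           (qpoch (inverse d) q (s - i) * qpoch (inverse d) q (t - r) /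
             (qpoch q q (s - i) * qpoch q q (t - r))) *
         (1 / qpoch (b\<^sup>2) q (i + r) * (qpoch b q i * qpoch b q r / (qpoch q q i * qpoch q q r)))
     = (d ^ (s - i) * qpoch (inverse d) q (s - i)) * (d ^ (t - r) * qpoch (inverse d) q (t - r)) *
        (qpoch b q i * qpoch b q r) /
        (qpoch (b\<^sup>2) q (i + r) * qpoch (b\<^sup>2 * q ^ (n + (i + r))) q (N - (i + r)) *
          (qpoch q q (s - i) * qpoch q q (t - r) * qpoch q q i * qpoch q q r))"
    unfolding dpow by (simp add: mult_ac)
  also have "\<dots> = (qpoch b q N)\<^sup>2 / qpoch (b\<^sup>2) q (n + N) * (node_weight q s i * node_weight q t r *
           (qpoch (b\<^sup>2 * q ^ (i + r)) q n / (qpoch (b * q ^ i) q t * qpoch (b * q ^ r) q s)))"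
    unfolding rev1 rev2 denom node_weight_def
    using b_nz b0_nz b2_nz b20_nz q_nz by (simp add: power2_eq_square mult_ac)
  finally show ?thesis .
qed

text \<open>The exponent of a product of two exponentials depends only on \<open>s = i + j\<close>, so the terms are
  collected by \<open>s\<close>, with \<open>r = k - i\<close> as the other free index.\<close>

lemma sum_triangle_reindex:
  fixes f :: "nat \<Rightarrow> nat \<Rightarrow> nat \<Rightarrow> 'a::comm_monoid_add"
  shows "(\<Sum>k\<le>N. \<Sum>j\<le>N - k. \<Sum>i\<le>k. f k j i) = (\<Sum>s\<le>N. \<Sum>i\<le>s. \<Sum>r\<le>N - s. f (i + r) (s - i) i)"
proof -
  have "(\<Sum>k\<le>N. \<Sum>j\<le>N - k. \<Sum>i\<le>k. f k j i)
      = (\<Sum>(k, j, i)\<in>(SIGMA k:{..N}. {..N - k} \<times> {..k}). f k j i)"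
    by (simp add: sum.Sigma sum.cartesian_product)
  also have "\<dots> = (\<Sum>(s, i, r)\<in>(SIGMA s:{..N}. {..s} \<times> {..N - s}). f (i + r) (s - i) i)"
    by (rule sum.reindex_bij_witness[of _ "\<lambda>(s, i, r). (i + r, s - i, i)" "\<lambda>(k, j, i). (i + j, i, k - i)"])
       auto
  also have "\<dots> = (\<Sum>s\<le>N. \<Sum>i\<le>s. \<Sum>r\<le>N - s. f (i + r) (s - i) i)"
    by (simp add: sum.Sigma sum.cartesian_product)
  finally show ?thesis .
qed

lemma ultraspherical_convolution_eq_0:
  assumes q: "q \<noteq> 0" and nroot: "\<And>k. k > 0 \<Longrightarrow> q ^ k \<noteq> 1"
    and "b \<noteq> 0" and b: "\<And>k. b * q ^ k \<noteq> 1" and b2: "\<And>k. b\<^sup>2 * q ^ k \<noteq> 1"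
    and N: "N = Suc n" and d: "d = b * q ^ n"
  shows "(\<Sum>k\<le>N. d ^ (N - k) / qpoch (b\<^sup>2 * q ^ (n + k)) q (N - k) *
           q_ultraspherical_sum (N - k) (inverse d) q \<theta> *
           (1 / qpoch (b\<^sup>2) q k * q_ultraspherical_sum k b q \<theta>)) = 0"
proof -
  define e where "e m = exp (\<i> * of_int m * \<theta>)" for m :: int
  have e_add: "e m * e m' = e (m + m')" for m m'
    by (simp add: e_def exp_add[symmetric] algebra_simps)
  define g where "g k j i = d ^ (N - k) / qpoch (b\<^sup>2 * q ^ (n + k)) q (N - k) *
      (qpoch (inverse d) q j * qpoch (inverse d) q (N - k - j) / (qpoch q q j * qpoch q q (N - k - j))) *
      (1 / qpoch (b\<^sup>2) q k * (qpoch b q i * qpoch b q (k - i) / (qpoch q q i * qpoch q q (k - i))))"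
    for k j i
  define K where "K = (qpoch b q N)\<^sup>2 / qpoch (b\<^sup>2) q (n + N)"
  have "(\<Sum>k\<le>N. d ^ (N - k) / qpoch (b\<^sup>2 * q ^ (n + k)) q (N - k) *
           q_ultraspherical_sum (N - k) (inverse d) q \<theta> *
           (1 / qpoch (b\<^sup>2) q k * q_ultraspherical_sum k b q \<theta>))
      = (\<Sum>k\<le>N. \<Sum>j\<le>N - k. \<Sum>i\<le>k. g k j i * (e (int (N - k) - 2 * int j) * e (int k - 2 * int i)))"
  proof -
    have product: "a * sum F A * (c * sum G B) = (\<Sum>j\<in>A. \<Sum>i\<in>B. a * F j * (c * G i))"
      for a c :: complex and F G and A B :: "nat set"
      by (subst sum.swap) (simp add: sum_distrib_left sum_distrib_right)
    show ?thesis
      unfolding q_ultraspherical_sum_def product g_def e_def by (simp only: mult_ac)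
  qed
  also have "\<dots> = (\<Sum>k\<le>N. \<Sum>j\<le>N - k. \<Sum>i\<le>k. g k j i * e (int N - 2 * int (i + j)))"
    unfolding e_add by (intro sum.cong refl arg_cong2[of _ _ _ _ times] arg_cong[of _ _ e]) auto
  also have "\<dots> = (\<Sum>s\<le>N. \<Sum>i\<le>s. \<Sum>r\<le>N - s. g (i + r) (s - i) i * e (int N - 2 * int (i + (s - i))))"
    by (rule sum_triangle_reindex)
  also have "\<dots> = (\<Sum>s\<le>N. K * e (int N - 2 * int s) *
      (\<Sum>i\<le>s. \<Sum>r\<le>N - s. node_weight q s i * node_weight q (N - s) r *
        (qpoch (b\<^sup>2 * q ^ (i + r)) q n / (qpoch (b * q ^ i) q (N - s) * qpoch (b * q ^ r) q s))))"
    unfolding sum_distrib_left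
  proof (intro sum.cong refl)
    fix s i r assume "s \<in> {..N}" "i \<in> {..s}" "r \<in> {..N - s}"
    then have le: "s \<le> N" "i \<le> s" "r \<le> N - s" by auto
    then have idx: "N - (i + r) - (s - i) = N - s - r" "i + r - i = r" "i + (s - i) = s" by auto
    show "g (i + r) (s - i) i * e (int N - 2 * int (i + (s - i))) =
       K * e (int N - 2 * int s) * (node_weight q s i * node_weight q (N - s) r *
        (qpoch (b\<^sup>2 * q ^ (i + r)) q n / (qpoch (b * q ^ i) q (N - s) * qpoch (b * q ^ r) q s)))"
      unfolding g_def idx
      using le by (subst node_weight_term[OF q nroot \<open>b \<noteq> 0\<close> b b2 N _ _ _ d]) (auto simp: K_def)
  qed
  also have "\<dots> = 0"
    using N by (intro sum.neutral ballI) (simp add: double_sum_eq_0[OF q nroot \<open>b \<noteq> 0\<close> b] del: times_divide_eq_right)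
  finally show ?thesis .
qed

text \<open>Counting rows from the column index \<open>n\<close> replaces the parameter \<open>\<beta>\<close> by \<open>\<beta> q\<^sup>n\<close> in both matrices, so
  each entry of \<open>M L\<close> depends only on this parameter and on the distance from the diagonal.\<close>

lemma L_matrix_shift:
  "L_matrix q \<beta> (cos \<theta>) (n + int k) n
       = 1 / qpoch ((\<beta> * q powi n)\<^sup>2) q k * q_ultraspherical_sum k (\<beta> * q powi n) q \<theta>"
  by (simp add: L_matrix_def poly_q_ultraspherical_cos power_mult_distrib power_int_mult mult.commute
        flip: power_int_power')

lemma M_matrix_shift:
  assumes "q \<noteq> 0" "\<beta> \<noteq> 0" "k \<le> Suc h" and d: "d = \<beta> * q powi n * q ^ h"
  shows "M_matrix q \<beta> (cos \<theta>) (n + int (Suc h)) (n + int k)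
       = d ^ (Suc h - k) / qpoch ((\<beta> * q powi n)\<^sup>2 * q ^ (h + k)) q (Suc h - k)
           * q_ultraspherical_sum (Suc h - k) (inverse d) q \<theta>"
proof -
  define p where "p = Suc h - k"
  have p: "n + int (Suc h) - (n + int k) = int p"
    using assms by (simp add: p_def)
  have d': "d = \<beta> * q powi (n + int h)"
    using assms by (simp add: power_int_add)
  have 1: "\<beta> powi int p * q powi ((n + int (Suc h) - 1) * int p) = d ^ p"
    by (simp add: d' power_mult_distrib power_int_mult)
  have 2: "\<beta>\<^sup>2 * q powi (n + int (Suc h) + (n + int k) - 1) = (\<beta> * q powi n)\<^sup>2 * q ^ (h + k)"
  proof -
    have "n + int (Suc h) + (n + int k) - 1 = n + n + int (h + k)" by simp
    then have "q powi (n + int (Suc h) + (n + int k) - 1) = q powi n * q powi n * q ^ (h + k)"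
      by (simp only: power_int_add[OF disjI1[OF \<open>q \<noteq> 0\<close>]] power_int_of_nat)
    then show ?thesis
      by (simp only: power2_eq_square mult_ac)
  qed
  have 3: "inverse \<beta> * q powi (1 - (n + int (Suc h))) = inverse d"
  proof -
    have "1 - (n + int (Suc h)) = - (n + int h)" by simp
    then show ?thesis by (simp only: d' power_int_minus inverse_mult_distrib)
  qed
  show ?thesis
    unfolding M_matrix_def p 1 2 3 poly_q_ultraspherical_cos nat_int p_def[symmetric]
    using assms by simp
qed

lemma M_L_eq_id:
  assumes q: "q \<noteq> 0" and nroot: "\<And>k. k > 0 \<Longrightarrow> q ^ k \<noteq> 1"
    and \<beta>: "\<beta> \<noteq> 0" and \<beta>2: "\<And>k::int. \<beta>\<^sup>2 \<noteq> q powi k"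
  shows "tri_mult (M_matrix q \<beta> x) (L_matrix q \<beta> x) = id_matrix"
proof (intro ext)
  fix m n :: int
  obtain \<theta> where x: "x = cos \<theta>" by (metis cos_Arccos)
  define b where "b = \<beta> * q powi n"
  have b_nz: "b \<noteq> 0" using q \<beta> by (simp add: b_def)
  have b2: "b\<^sup>2 * q ^ k \<noteq> 1" for k
  proof
    assume "b\<^sup>2 * q ^ k = 1"
    moreover have "b\<^sup>2 * q ^ k = \<beta>\<^sup>2 * q powi (2 * n + int k)"
      using q by (simp add: b_def power_int_add power_int_mult power_mult_distrib power2_eq_square
                       mult_2 mult_ac)
    ultimately have "\<beta>\<^sup>2 = q powi (- (2 * n + int k))"
      unfolding power_int_minus by (metis inverse_unique mult.commute)
    then show False using \<beta>2 by blast
  qed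
  have b1: "b * q ^ k \<noteq> 1" for k
  proof
    assume "b * q ^ k = 1"
    then have "(b * q ^ k)\<^sup>2 = 1" by simp
    then have "b\<^sup>2 * q ^ (2 * k) = 1"
      by (simp add: power_mult_distrib power_mult[symmetric] mult.commute)
    then show False using b2 by blast
  qed
  consider "m < n" | "m = n" | h where "m = n + int (Suc h)"
    by (metis add.right_neutral int_ops(1) not0_implies_Suc not_less zle_iff_zadd)
  then show "tri_mult (M_matrix q \<beta> x) (L_matrix q \<beta> x) m n = id_matrix m n"
  proof cases
    case 1
    then show ?thesis by (simp add: tri_mult_def id_matrix_def)
  next
    case 2
    then show ?thesis
      by (simp add: tri_mult_def id_matrix_def M_matrix_def L_matrix_def x poly_q_ultraspherical_cos
            q_ultraspherical_sum_def qpoch_def)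
  next
    case 3
    define d where "d = b * q ^ h"
    have "tri_mult (M_matrix q \<beta> x) (L_matrix q \<beta> x) m n
        = (\<Sum>k=n..n + int (Suc h). M_matrix q \<beta> x m k * L_matrix q \<beta> x k n)"
      by (simp add: tri_mult_def 3)
    also have "\<dots> = (\<Sum>k\<le>Suc h. M_matrix q \<beta> x m (n + int k) * L_matrix q \<beta> x (n + int k) n)"
      by (rule sum.reindex_bij_witness[of _ "\<lambda>k. n + int k" "\<lambda>k. nat (k - n)"]) auto
    also have "\<dots> = (\<Sum>k\<le>Suc h. d ^ (Suc h - k) / qpoch (b\<^sup>2 * q ^ (h + k)) q (Suc h - k) *
           q_ultraspherical_sum (Suc h - k) (inverse d) q \<theta> *
           (1 / qpoch (b\<^sup>2) q k * q_ultraspherical_sum k b q \<theta>))"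
    proof (intro sum.cong refl)
      fix k assume "k \<in> {..Suc h}"
      then have "k \<le> Suc h" by simp
      have "M_matrix q \<beta> x m (n + int k) = d ^ (Suc h - k) / qpoch (b\<^sup>2 * q ^ (h + k)) q (Suc h - k) *
              q_ultraspherical_sum (Suc h - k) (inverse d) q \<theta>"
        unfolding x 3 b_def by (rule M_matrix_shift[OF q \<beta> \<open>k \<le> Suc h\<close>]) (simp add: d_def b_def)
      then show "M_matrix q \<beta> x m (n + int k) * L_matrix q \<beta> x (n + int k) n
          = d ^ (Suc h - k) / qpoch (b\<^sup>2 * q ^ (h + k)) q (Suc h - k) *
              q_ultraspherical_sum (Suc h - k) (inverse d) q \<theta> *
              (1 / qpoch (b\<^sup>2) q k * q_ultraspherical_sum k b q \<theta>)"
        by (simp only: x L_matrix_shift b_def)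
    qed
    also have "\<dots> = 0"
      by (rule ultraspherical_convolution_eq_0[OF q nroot b_nz b1 b2 refl d_def])
    finally show ?thesis by (simp add: 3 id_matrix_def)
  qed
qed

theorem theorem1p1:
  fixes q :: real and \<beta> x :: complex
  assumes "0 < q" and "q < 1"
    and "\<beta> \<noteq> 0"
    and "\<forall>k::int. \<beta>^2 \<noteq> complex_of_real q powi k"
  shows "tri_mult (L_matrix (complex_of_real q) \<beta> x) (M_matrix (complex_of_real q) \<beta> x) = id_matrix
       \<and> tri_mult (M_matrix (complex_of_real q) \<beta> x) (L_matrix (complex_of_real q) \<beta> x) = id_matrix"
proof -
  have "complex_of_real q ^ k \<noteq> 1" if "k > 0" for k
  proof -
    have "q ^ k < 1" using assms that by (simp add: power_less_one_iff)
    then show ?thesis by (metis of_real_eq_1_iff of_real_power less_irrefl)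
  qed
  then have "tri_mult (M_matrix (complex_of_real q) \<beta> x) (L_matrix (complex_of_real q) \<beta> x) = id_matrix"
    using assms by (intro M_L_eq_id) auto
  then show ?thesis
    using tri_mult_left_inverse_imp_right by blast
qed

end
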